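(* For every integer $d\ge 4$ we have $f(d)=2^{d}$. More precisely, for every integer $d\ge 4$ there are infinitely many pairwise nonisomorphic finite simple $d$-regular bipartite graphs carrying a linear connectivity code of dimension $d$.
   Context: Graphs are finite and simple. Let $H=(V,E)$ be a graph. A spanning subgraph of $H$ is identified with its edge set $A\subseteq E$ (its vertex set is all of $V$); it is called connected and spanning if the graph $(V,A)$ is connected. A family $\mathcal{C}\subseteq 2^{E}$ is a connectivity code for $H$ if for all distinct $A,B\in\mathcal{C}$ the symmetric difference $A\triangle B$ is a connected spanning subgraph of $H$. The maximum cardinality of a connectivity code for $H$ is denoted $m(H)$. A connectivity code $\mathcal{C}$ is linear if, identifying $2^{E}$ with the vector space $\mathbb{F}_2^{E}$ (addition is symmetric difference), $\mathcal{C}$ is a linear subspace; its dimension is its dimension over $\mathbb{F}_2$. For $d\ge 2$, $$f(d)=\max\{\,q : m(H)=q \text{ for infinitely many pairwise nonisomorphic } d\text{-regular graphs } H\,\}.$$ *)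

theory Defs
  imports Complex_Main "HOL-Library.Z2" "HOL-Library.Function_Algebras"
begin

datatype 'a graph = Graph (verts: "'a set") (edges: "'a set set")

definition simple_graph :: "'a graph \<Rightarrow> bool" where
  "simple_graph H \<longleftrightarrow> finite (verts H) \<and> (\<forall>e\<in>edges H. e \<subseteq> verts H \<and> card e = 2)"

definition degree :: "'a graph \<Rightarrow> 'a \<Rightarrow> nat" where
  "degree H v = card {e \<in> edges H. v \<in> e}"

definition regular :: "nat \<Rightarrow> 'a graph \<Rightarrow> bool" where
  "regular d H \<longleftrightarrow> (\<forall>v\<in>verts H. degree H v = d)"

definition bipartite :: "'a graph \<Rightarrow> bool" where
  "bipartite H \<longleftrightarrow> (\<exists>X Y. X \<union> Y = verts H \<and> X \<inter> Y = {} \<and>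
     (\<forall>e\<in>edges H. \<exists>x\<in>X. \<exists>y\<in>Y. e = {x, y}))"

definition isomorphic :: "'a graph \<Rightarrow> 'b graph \<Rightarrow> bool" where
  "isomorphic G H \<longleftrightarrow> (\<exists>\<phi>. bij_betw \<phi> (verts G) (verts H) \<and>
     (\<forall>u\<in>verts G. \<forall>v\<in>verts G. {u, v} \<in> edges G \<longleftrightarrow> {\<phi> u, \<phi> v} \<in> edges H))"

text \<open>Finite graphs are represented up to isomorphism by graphs whose vertices are natural numbers.\<close>

definition infinitely_many_nonisomorphic :: "(nat graph \<Rightarrow> bool) \<Rightarrow> bool" where
  "infinitely_many_nonisomorphic P \<longleftrightarrow>
     (\<exists>S. infinite S \<and> pairwise (\<lambda>G H. \<not> isomorphic G H) S \<and> (\<forall>H\<in>S. P H))"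

definition connected_graph :: "'a graph \<Rightarrow> bool" where
  "connected_graph G \<longleftrightarrow> verts G \<noteq> {} \<and>
     (\<forall>u\<in>verts G. \<forall>v\<in>verts G. (u, v) \<in> {(x, y). {x, y} \<in> edges G}\<^sup>*)"

definition connected_spanning :: "'a graph \<Rightarrow> 'a set set \<Rightarrow> bool" where
  "connected_spanning H A \<longleftrightarrow> A \<subseteq> edges H \<and> connected_graph (Graph (verts H) A)"

definition connectivity_code :: "'a graph \<Rightarrow> 'a set set set \<Rightarrow> bool" where
  "connectivity_code H \<C> \<longleftrightarrow> \<C> \<subseteq> Pow (edges H) \<and>
     (\<forall>A\<in>\<C>. \<forall>B\<in>\<C>. A \<noteq> B \<longrightarrow> connected_spanning H (sym_diff A B))"

definition max_code_size :: "'a graph \<Rightarrow> nat" where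
  "max_code_size H = Max (card ` {\<C>. connectivity_code H \<C>})"

text \<open>
  For a graph with edge set \<open>E\<close>, the space \<open>\<F>\<^sub>2\<^sup>E\<close> is the subspace of all functions into the
  two-element field \<^typ>\<open>bit\<close> that vanish outside \<open>E\<close>; a subset of \<open>E\<close> corresponds to its
  characteristic vector.
\<close>

definition f2_scale :: "bit \<Rightarrow> ('e \<Rightarrow> bit) \<Rightarrow> 'e \<Rightarrow> bit" where
  "f2_scale c x = (\<lambda>e. c * x e)"

lemma vector_space_f2_scale: "vector_space f2_scale"
  by unfold_locales (auto simp: f2_scale_def fun_eq_iff algebra_simps)

definition char_vec :: "'e set \<Rightarrow> 'e \<Rightarrow> bit" where
  "char_vec A = (\<lambda>e. of_bool (e \<in> A))"

lemma char_vec_sym_diff: "char_vec (sym_diff A B) = char_vec A + char_vec B"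
  by (auto simp: char_vec_def fun_eq_iff)

definition linear_code :: "'a graph \<Rightarrow> 'a set set set \<Rightarrow> bool" where
  "linear_code H \<C> \<longleftrightarrow> connectivity_code H \<C> \<and> module.subspace f2_scale (char_vec ` \<C>)"

definition code_dim :: "'a set set set \<Rightarrow> nat" where
  "code_dim \<C> = vector_space.dim f2_scale (char_vec ` \<C>)"

definition recurring_code_sizes :: "nat \<Rightarrow> nat set" where
  "recurring_code_sizes d = {q. infinitely_many_nonisomorphic
     (\<lambda>H. simple_graph H \<and> regular d H \<and> max_code_size H = q)}"

text \<open>
  The paper's \<open>f\<close>. The set is bounded for \<open>d > 0\<close>, as shown in
  \<open>recurring_code_sizes_le\<close> below, so the maximum is not taken over an infinite set.
\<close>

definition f_max :: "nat \<Rightarrow> nat" where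
  "f_max d = Max (recurring_code_sizes d)"

lemma finite_edges: "simple_graph H \<Longrightarrow> finite (edges H)"
  unfolding simple_graph_def by (meson PowI finite_Pow_iff finite_subset subsetI)

lemma code_card_le:
  assumes H: "simple_graph H" and reg: "regular d H" and d: "d > 0"
    and C: "connectivity_code H \<C>"
  shows "card \<C> \<le> 2 ^ d"
proof (cases "verts H = {}")
  case True
  then have "edges H = {}" using H by (auto simp: simple_graph_def)
  then have "\<C> \<subseteq> {{}}" using C by (auto simp: connectivity_code_def)
  then have "card \<C> \<le> 1" using card_mono[of "{{}}" \<C>] by simp
  then show ?thesis by (meson le_trans one_le_numeral one_le_power)
next
  case False
  then obtain v where v: "v \<in> verts H" by blast
  define star where "star = {e \<in> edges H. v \<in> e}"
  have cs: "card star = d" using reg v by (simp add: regular_def degree_def star_def)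
  with d have "star \<noteq> {}" by auto
  then obtain e where e: "e \<in> edges H" "v \<in> e" by (auto simp: star_def)
  then have "card e = 2" "e \<subseteq> verts H" using H by (auto simp: simple_graph_def)
  then obtain w where w: "w \<in> verts H" "w \<noteq> v" using e
    by (auto simp: card_2_iff)
  have fin: "finite star" using finite_edges[OF H] by (simp add: star_def)
  have "inj_on (\<lambda>A. A \<inter> star) \<C>"
  proof (rule inj_onI, rule ccontr)
    fix A B assume AB: "A \<in> \<C>" "B \<in> \<C>" "A \<inter> star = B \<inter> star" "A \<noteq> B"
    then have "connected_spanning H (sym_diff A B)" using C by (auto simp: connectivity_code_def)
    then have "(v, w) \<in> {(x, y). {x, y} \<in> sym_diff A B}\<^sup>*"
      using v w by (auto simp: connected_spanning_def connected_graph_def)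
    then obtain y where "{v, y} \<in> sym_diff A B" using w by (auto elim: converse_rtranclE)
    moreover have "sym_diff A B \<subseteq> edges H" using C AB by (auto simp: connectivity_code_def)
    ultimately have "{v, y} \<in> star" "{v, y} \<in> sym_diff A B" by (auto simp: star_def)
    then show False using AB(3) by blast
  qed
  moreover have "(\<lambda>A. A \<inter> star) ` \<C> \<subseteq> Pow star" by auto
  ultimately have "card \<C> \<le> card (Pow star)"
    using fin by (meson card_inj_on_le finite_Pow_iff)
  then show ?thesis using fin cs by (simp add: card_Pow)
qed

lemma recurring_code_sizes_le:
  assumes d: "d > 0" and q: "q \<in> recurring_code_sizes d"
  shows "q \<le> 2 ^ d"
proof -
  obtain S :: "nat graph set" where "infinite S"
    and S: "\<And>H. H \<in> S \<Longrightarrow> simple_graph H \<and> regular d H \<and> max_code_size H = q"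
    using q unfolding recurring_code_sizes_def infinitely_many_nonisomorphic_def by blast
  then obtain H where "H \<in> S" by (metis all_not_in_conv finite.emptyI)
  then have H: "simple_graph H" "regular d H" "max_code_size H = q" using S by auto
  let ?K = "{\<C>. connectivity_code H \<C>}"
  have "?K \<subseteq> Pow (Pow (edges H))" by (auto simp: connectivity_code_def)
  then have fin: "finite ?K" using finite_edges[OF H(1)] by (meson finite_Pow_iff finite_subset)
  have "{} \<in> ?K" by (simp add: connectivity_code_def)
  then have "Max (card ` ?K) \<in> card ` ?K" using fin by (intro Max_in) auto
  then obtain \<C> where "connectivity_code H \<C>" "card \<C> = q" using H(3) by (auto simp: max_code_size_def)
  then show ?thesis using code_card_le[OF H(1,2) d] by blast
qed

end

theory Submission
  imports Defs
begin

text \<open>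
  A linear code of dimension \<open>d\<close> is a labelling of the edges by linear functionals on \<open>\<F>\<^sub>2\<^sup>d\<close> such that
  for every nonzero vector \<open>L\<close> the edges whose label does not vanish at \<open>L\<close> connect the graph.

  For \<open>d = 4\<close>, take the circulant bipartite graph on \<open>\<int>/N + \<int>/N\<close> with \<open>15\<close> dividing \<open>N\<close> and edges
  \<open>x \<midarrow> x + k\<close>, \<open>k = 0, 1, 2, 3\<close>. A codeword comes from a sequence \<open>u\<close> with
  \<open>u(x + 4) = u(x) + u(x + 1)\<close> over \<open>\<F>\<^sub>2\<close>, and contains the edge \<open>x \<midarrow> x + k\<close> iff \<open>u(x + b\<^sub>k) = 1\<close>.
  The recurrence is primitive, so all nonzero solutions are translates of a single sequence of
  period 15, and connectivity has to be checked for one periodic pattern only.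

  From \<open>d\<close> to \<open>d + 1\<close>, take three copies of the graph and join each left vertex of copy \<open>c\<close> to the
  corresponding right vertex of copy \<open>c + 1\<close> (modulo 3). The labels of copy \<open>c\<close> are pulled back along
  \<open>\<F>\<^sub>2\<^sup>d\<^sup>+\<^sup>1 \<rightarrow> \<F>\<^sub>2\<^sup>d\<close> with kernel \<open>{0, w\<^sub>c}\<close>, for linearly independent \<open>w\<^sub>0, w\<^sub>1, w\<^sub>2\<close>. At \<open>L = w\<^sub>c\<close>
  copy \<open>c\<close> falls apart into isolated vertices, which is repaired by letting all joining edges at
  copy \<open>c\<close> be nonzero at \<open>w\<^sub>c\<close>; subject to this the labels of the edges between two copies are as varied
  as possible, so that the only nonzero vector at which they all vanish is the sum of the two.
\<close>

text \<open>
  Connectivity of the bipartite graph on \<open>{..<N} + {..<N}\<close>, phrased by two-colourings: a colouring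
  constant along edges is constant.
\<close>

definition bip_connected :: "nat \<Rightarrow> (nat \<times> nat) set \<Rightarrow> bool" where
  "bip_connected N B \<longleftrightarrow> (\<forall>f g :: nat \<Rightarrow> bool.
     (\<forall>i j. (i, j) \<in> B \<longrightarrow> f i = g j) \<longrightarrow> (\<forall>i<N. \<forall>j<N. f i = g j))"

text \<open>A vector of \<open>\<F>\<^sub>2\<^sup>d\<close> is a set \<open>L \<subseteq> {..<d}\<close>, and \<open>A L\<close> is the corresponding codeword.\<close>

definition bip_code ::
    "nat \<Rightarrow> nat \<Rightarrow> (nat \<times> nat) set \<Rightarrow> (nat set \<Rightarrow> (nat \<times> nat) set) \<Rightarrow> bool" where
  "bip_code d N E A \<longleftrightarrow> d \<le> N \<and> E \<subseteq> {..<N} \<times> {..<N} \<and>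
     (\<forall>i<N. card {j. (i, j) \<in> E} = d) \<and> (\<forall>j<N. card {i. (i, j) \<in> E} = d) \<and>
     (\<forall>L. A L \<subseteq> E) \<and> (\<forall>L M. A (sym_diff L M) = sym_diff (A L) (A M)) \<and>
     (\<forall>L\<subseteq>{..<d}. L \<noteq> {} \<longrightarrow> bip_connected N (A L))"

lemma bip_codeD:
  assumes "bip_code d N E A"
  shows "d \<le> N" "E \<subseteq> {..<N} \<times> {..<N}"
    "\<And>i. i < N \<Longrightarrow> card {j. (i, j) \<in> E} = d" "\<And>j. j < N \<Longrightarrow> card {i. (i, j) \<in> E} = d"
    "\<And>L. A L \<subseteq> E" "\<And>L M. A (sym_diff L M) = sym_diff (A L) (A M)"
    "\<And>L. L \<subseteq> {..<d} \<Longrightarrow> L \<noteq> {} \<Longrightarrow> bip_connected N (A L)"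
  using assms unfolding bip_code_def by iprover+

subsection \<open>Dimension four\<close>

text \<open>The m-sequence of the primitive polynomial X^4 + X + 1, started at 1, 0, 0, 0.\<close>

definition mseq :: "nat \<Rightarrow> bool" where
  "mseq n \<longleftrightarrow> n mod 15 \<in> {0, 4, 7, 8, 10, 12, 13, 14}"

lemma mseq_add_15: "mseq (n + 15) = mseq n"
  by (simp add: mseq_def)

text \<open>Since 15 divides \<open>N\<close>, the periodic pattern is well defined on residues
  modulo \<open>N\<close>.\<close>

lemma mseq_mod: "15 dvd N \<Longrightarrow> mseq (x mod N + k) = mseq (x + k)"
proof -
  assume "15 dvd N"
  then have "x mod N mod 15 = x mod 15" by (rule mod_mod_cancel)
  then have "(x mod N + k) mod 15 = (x + k) mod 15" by (rule mod_add_cong) simp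
  then show ?thesis by (simp only: mseq_def)
qed

lemma mseq_rec: "mseq (n + 4) \<longleftrightarrow> mseq n \<noteq> mseq (n + 1)"
proof -
  define r where "r = n mod 15"
  have m: "(n + 4) mod 15 = (r + 4) mod 15" "(n + 1) mod 15 = (r + 1) mod 15"
    unfolding r_def by (simp_all only: mod_add_left_eq)
  have "r < 15" by (simp add: r_def)
  then have "r = 0 \<or> r = 1 \<or> r = 2 \<or> r = 3 \<or> r = 4 \<or> r = 5 \<or> r = 6 \<or> r = 7 \<or> r = 8 \<or>
    r = 9 \<or> r = 10 \<or> r = 11 \<or> r = 12 \<or> r = 13 \<or> r = 14" by presburger
  then show ?thesis
    unfolding mseq_def m r_def[symmetric] by (elim disjE) simp_all
qed

definition lfsr :: "nat set \<Rightarrow> nat \<Rightarrow> bool" where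
  "lfsr L n \<longleftrightarrow> ((0 \<in> L \<and> mseq n) \<noteq> (1 \<in> L \<and> mseq (n + 1)))
     \<noteq> ((2 \<in> L \<and> mseq (n + 2)) \<noteq> (3 \<in> L \<and> mseq (n + 3)))"

text \<open>Let alpha in F_16 satisfy alpha^4 = alpha + 1. Translation by j acts on solutions as
  multiplication by alpha^j, so \<open>L\<close> acts as the sum of alpha^j over j in
  \<open>L\<close>. This sum is nonzero, hence a power alpha^c, and acts as translation by
  c.\<close>

lemma lfsr_shift:
  assumes "L \<subseteq> {..<4}" "L \<noteq> {}"
  obtains c where "c < 15" "\<And>n. lfsr L n = mseq (n + c)"
proof -
  have rec: "mseq (n + j) = (mseq (n + i) \<noteq> mseq (n + k))" if "j = i + 4" "k = i + 1" for n i j k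
    using mseq_rec[of "n + i"] that by (simp add: add.assoc)
  have r: "mseq (n + 4) = (mseq n \<noteq> mseq (n + 1))"
    "mseq (n + 5) = (mseq (n + 1) \<noteq> mseq (n + 2))"
    "mseq (n + 6) = (mseq (n + 2) \<noteq> mseq (n + 3))"
    "mseq (n + 7) = (mseq (n + 3) \<noteq> mseq (n + 4))"
    "mseq (n + 8) = (mseq (n + 4) \<noteq> mseq (n + 5))"
    "mseq (n + 9) = (mseq (n + 5) \<noteq> mseq (n + 6))"
    "mseq (n + 10) = (mseq (n + 6) \<noteq> mseq (n + 7))"
    "mseq (n + 11) = (mseq (n + 7) \<noteq> mseq (n + 8))"
    "mseq (n + 12) = (mseq (n + 8) \<noteq> mseq (n + 9))"
    "mseq (n + 13) = (mseq (n + 9) \<noteq> mseq (n + 10))"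
    "mseq (n + 14) = (mseq (n + 10) \<noteq> mseq (n + 11))" for n
    by (rule mseq_rec) (rule rec; simp)+
  have ne: "0 \<in> L \<or> 1 \<in> L \<or> 2 \<in> L \<or> 3 \<in> L"
  proof -
    obtain i where "i \<in> L" "i < 4" using assms by auto
    moreover from \<open>i < 4\<close> have "i = 0 \<or> i = 1 \<or> i = 2 \<or> i = 3" by arith
    ultimately show ?thesis by auto
  qed
  \<comment> \<open>A table of discrete logarithms to base alpha. The last branch, meant for
    \<open>L = {3}\<close>, also catches the empty set, which \<open>ne\<close> excludes.\<close>
  define c :: nat where "c =
    (if 0 \<in> L then
       if 1 \<in> L then if 2 \<in> L then if 3 \<in> L then 12 else 10 else if 3 \<in> L then 7 else 4
       else if 2 \<in> L then if 3 \<in> L then 13 else 8 else if 3 \<in> L then 14 else 0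
     else
       if 1 \<in> L then if 2 \<in> L then if 3 \<in> L then 11 else 5 else if 3 \<in> L then 9 else 1
       else if 2 \<in> L then if 3 \<in> L then 6 else 2 else 3)"
  have "lfsr L n = mseq (n + c)" for n
    using ne r[of n] unfolding lfsr_def c_def
    by (cases "0 \<in> L"; cases "1 \<in> L"; cases "2 \<in> L"; cases "3 \<in> L";
      simp only: simp_thms if_True if_False add_0_right; argo?)
  moreover have "c < 15" by (simp add: c_def)
  ultimately show ?thesis using that by blast
qed

text \<open>These offsets \<open>b\<^sub>k\<close> were found by a computer search.\<close>

definition offset :: "nat \<Rightarrow> nat" where
  "offset k = [0, 12, 4, 8] ! k"

lemma offset_simps: "offset 0 = 0" "offset (Suc 0) = 12" "offset 2 = 4" "offset 3 = 8"
  by (simp_all add: offset_def)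

text \<open>Here the vertices are natural numbers without wrap-around. The pattern has period 15, so
  it suffices to explore one window; its endpoint \<open>r = 15\<close> is included because it
  starts the next one.\<close>

lemma mseq_window:
  fixes F G :: "nat \<Rightarrow> bool"
  assumes eq: "\<And>z k. k < 4 \<Longrightarrow> mseq (z + offset k) \<Longrightarrow> F z = G (z + k)" and x: "15 dvd x"
  shows "r \<le> 15 \<Longrightarrow> F (x + r) = F x \<and> G (x + r) = F x"
proof -
  obtain q where q: "x = 15 * q" using x by blast
  have e: "F (x + r) = G (x + r + k)" if "k < 4" "(r + offset k) mod 15 \<in> {0, 4, 7, 8, 10, 12, 13, 14}" for r k
    using eq[of k "x + r"] that by (simp add: mseq_def q mod_mult_self4 add.assoc)
  \<comment> \<open>For each k, the listed \<open>r\<close> are the positions at which the pattern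
    contains the edge from \<open>x + r\<close> to \<open>x + r + k\<close>.\<close>
  have e0: "F (x + r) = G (x + r)" if "r \<in> {0, 4, 7, 8, 10, 12, 13, 14, 15}" for r
    using e[of 0 r] that by (auto simp: offset_simps add.assoc)
  have e1: "F (x + r) = G (x + (r + 1))" if "r \<in> {0, 1, 2, 3, 7, 10, 11, 13, 15, 16}" for r
    using e[of 1 r] that by (auto simp: offset_simps add.assoc)
  have e2: "F (x + r) = G (x + (r + 2))" if "r \<in> {0, 3, 4, 6, 8, 9, 10, 11, 15}" for r
    using e[of 2 r] that by (auto simp: offset_simps add.assoc)
  have e3: "F (x + r) = G (x + (r + 3))" if "r \<in> {0, 2, 4, 5, 6, 7, 11, 14, 15}" for r
    using e[of 3 r] that by (auto simp: offset_simps add.assoc)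
  \<comment> \<open>All four offsets are positions of ones of \<open>mseq\<close>, so the left
    vertex \<open>x\<close> has all four edges. The facts \<open>c2\<close> to \<open>c4\<close>
    extend the search from there.\<close>
  have c1: "G x = F x" "G (x + 1) = F x" "G (x + 2) = F x" "G (x + 3) = F x"
    using e0[of 0] e1[of 0] e2[of 0] e3[of 0] by simp_all
  have c2: "F (x + 1) = F x" "F (x + 2) = F x" "G (x + 5) = F x" "F (x + 3) = F x"
    "G (x + 4) = F x" "F (x + 4) = F x" "G (x + 6) = F x" "G (x + 7) = F x" "F (x + 7) = F x"
    using c1 e1[of 1] e1[of 2] e3[of 2] e2[of 3] e1[of 3] e0[of 4] e2[of 4] e3[of 4] e0[of 7]
    by simp_all
  have c3: "G (x + 8) = F x" "G (x + 10) = F x" "F (x + 5) = F x" "F (x + 6) = F x"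
    "F (x + 8) = F x" "F (x + 10) = F x" "G (x + 9) = F x" "G (x + 11) = F x" "G (x + 12) = F x"
    using c2 e1[of 7] e3[of 7] e3[of 5] e2[of 6] e0[of 8] e0[of 10] e3[of 6] e1[of 10] e2[of 10]
    by simp_all
  \<comment> \<open>The left vertices \<open>x + 14\<close> and \<open>x + 15\<close> share the
    right neighbour \<open>x + 17\<close>, which leads into the next window.\<close>
  have c4: "F (x + 9) = F x" "F (x + 11) = F x" "F (x + 12) = F x" "G (x + 13) = F x"
    "G (x + 14) = F x" "F (x + 13) = F x" "F (x + 14) = F x" "F (x + 15) = F x" "G (x + 15) = F x"
    using c3 e2[of 9] e1[of 11] e0[of 12] e2[of 11] e3[of 11] e0[of 13] e0[of 14] e3[of 14]
      e2[of 15] e0[of 15]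
    by simp_all
  have *: "\<forall>r\<in>{0,1,2,3,4,5,6,7,8,9,10,11,12,13,14,15}. F (x + r) = F x \<and> G (x + r) = F x"
    using c1 c2 c3 c4 by simp
  assume "r \<le> 15"
  then have "r \<in> {0,1,2,3,4,5,6,7,8,9,10,11,12,13,14,15}" by simp presburger
  then show ?thesis using * by blast
qed


text \<open>Consecutive windows share an endpoint, so the constant carries over from each to the
  next.\<close>

lemma mseq_const:
  fixes F G :: "nat \<Rightarrow> bool"
  assumes eq: "\<And>z k. k < 4 \<Longrightarrow> mseq (z + offset k) \<Longrightarrow> F z = G (z + k)"
  shows "F z = F 0 \<and> G z = F 0"
proof -
  have "F (15 * q) = F 0" for q
  proof (induction q)
    case (Suc q)
    then show ?case using mseq_window[of F G "15 * q" 15, OF eq] by (simp add: add.commute)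
  qed simp
  then show ?thesis
    using mseq_window[of F G "15 * (z div 15)" "z mod 15", OF eq] by simp
qed

text \<open>Colourings of the cyclic graph are lifted to the natural numbers and translated, so that
  the codeword of \<open>L\<close> becomes the standard pattern \<open>mseq\<close>.\<close>

lemma bip_connected_lfsr:
  assumes N: "15 dvd N" "0 < N" and L: "L \<subseteq> {..<4}" "L \<noteq> {}"
    and B: "\<And>x k. x < N \<Longrightarrow> k < 4 \<Longrightarrow> lfsr L (x + offset k) \<Longrightarrow> (x, (x + k) mod N) \<in> B"
  shows "bip_connected N B"
  unfolding bip_connected_def
proof (intro allI impI)
  fix f g :: "nat \<Rightarrow> bool" and i j
  assume fg: "\<forall>i j. (i, j) \<in> B \<longrightarrow> f i = g j" and ij: "i < N" "j < N"
  obtain c where c: "c < 15" "\<And>n. lfsr L n = mseq (n + c)" using lfsr_shift L by blast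
  have eq: "f (z mod N) = g ((z + k) mod N)" if "k < 4" "mseq (z + c + offset k)" for z k
  proof -
    have "lfsr L (z mod N + offset k)"
      using that N by (simp add: c(2) mseq_mod add.assoc add.commute[of c])
    then have "(z mod N, (z mod N + k) mod N) \<in> B" using B that N by simp
    then show ?thesis using fg by (simp add: mod_add_left_eq)
  qed
  \<comment> \<open>Translation by \<open>-c\<close>, written as \<open>15 - c\<close> to stay in
    the natural numbers; the surplus 15 is a period of \<open>mseq\<close>.\<close>
  define F where "F z = f ((z + (15 - c)) mod N)" for z
  define G where "G z = g ((z + (15 - c)) mod N)" for z
  have "F z = G (z + k)" if "k < 4" "mseq (z + offset k)" for z k
  proof -
    have "z + (15 - c) + c + offset k = z + offset k + 15" using c(1) by simp
    then have "mseq (z + (15 - c) + c + offset k)" using that(2) by (simp only: mseq_add_15)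
    from eq[OF that(1) this] show ?thesis by (simp add: F_def G_def add_ac)
  qed
  then have const: "F z = F 0 \<and> G z = F 0" for z by (rule mseq_const)
  \<comment> \<open>This lets \<open>N - (15 - c)\<close> undo the translation modulo
    \<open>N\<close>.\<close>
  have "15 \<le> N" using N by (simp add: dvd_imp_le)
  then have "f i = F (i + (N - (15 - c)))" "g j = G (j + (N - (15 - c)))"
    using ij c(1) by (simp_all add: F_def G_def)
  then show "f i = g j" using const by simp
qed

section \<open>Neighbourhoods in circulant bipartite graphs\<close>

lemma circulant_diff:
  assumes "x < (N :: nat)" "y < N" "k < N"
  shows "(y + N - x) mod N = k \<longleftrightarrow> y = (x + k) mod N"
    and "(y + N - x) mod N = k \<longleftrightarrow> x = (y + N - k) mod N"
proof -
  \<comment> \<open>Adding \<open>N\<close> first keeps the truncated subtraction exact, so this is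
    the difference y - x in Z/N.\<close>
  have m: "(y + N - x) mod N = (if x \<le> y then y - x else y + N - x)"
    "(x + k) mod N = (if x + k < N then x + k else x + k - N)"
    "(y + N - k) mod N = (if k \<le> y then y - k else y + N - k)"
    using assms by (simp_all add: mod_if)
  show "(y + N - x) mod N = k \<longleftrightarrow> y = (x + k) mod N"
    and "(y + N - x) mod N = k \<longleftrightarrow> x = (y + N - k) mod N"
    unfolding m using assms by (cases "x \<le> y"; auto)+
qed

lemma card_circulant:
  assumes k: "k \<le> N" and x: "x < (N :: nat)"
  shows "card ((\<lambda>s. (x + s) mod N) ` {..<k}) = k"
    and "card ((\<lambda>s. (x + N - s) mod N) ` {..<k}) = k"
proof -
  have "inj_on (\<lambda>s. (x + s) mod N) {..<k}"
  proof (rule inj_on_inverseI)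
    fix s assume "s \<in> {..<k}"
    then show "((x + s) mod N + N - x) mod N = s"
      using circulant_diff(1)[of x N "(x + s) mod N" s] k x by simp
  qed
  then show "card ((\<lambda>s. (x + s) mod N) ` {..<k}) = k" by (simp add: card_image)
  have "inj_on (\<lambda>s. (x + N - s) mod N) {..<k}"
  proof (rule inj_on_inverseI)
    fix s assume "s \<in> {..<k}"
    then show "(x + N - (x + N - s) mod N) mod N = s"
      using circulant_diff(2)[of "(x + N - s) mod N" N x s] k x by simp
  qed
  then show "card ((\<lambda>s. (x + N - s) mod N) ` {..<k}) = k" by (simp add: card_image)
qed

lemma circulant_nbrs:
  assumes k: "k \<le> (N :: nat)" and x: "x < N"
  shows "{y. y < N \<and> (y + N - x) mod N < k} = (\<lambda>s. (x + s) mod N) ` {..<k}"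
    and "{y. y < N \<and> (x + N - y) mod N < k} = (\<lambda>s. (x + N - s) mod N) ` {..<k}"
proof -
  have *: "y \<in> (\<lambda>s. h s mod N) ` {..<k}" if "e < k" "y = h e mod N" for h :: "nat \<Rightarrow> nat" and y e
    using that by blast
  show "{y. y < N \<and> (y + N - x) mod N < k} = (\<lambda>s. (x + s) mod N) ` {..<k}"
  proof (intro subset_antisym subsetI)
    fix y assume "y \<in> {y. y < N \<and> (y + N - x) mod N < k}"
    then show "y \<in> (\<lambda>s. (x + s) mod N) ` {..<k}"
      using circulant_diff(1)[of x N y "(y + N - x) mod N"] x by (intro *) auto
  next
    fix y assume "y \<in> (\<lambda>s. (x + s) mod N) ` {..<k}"
    then obtain t where t: "t < k" "y = (x + t) mod N" by blast
    then have "y < N" using x by simp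
    moreover have "(y + N - x) mod N = t"
      using circulant_diff(1)[of x N y t] x k t \<open>y < N\<close> by simp
    ultimately show "y \<in> {y. y < N \<and> (y + N - x) mod N < k}" using t by simp
  qed
  show "{y. y < N \<and> (x + N - y) mod N < k} = (\<lambda>s. (x + N - s) mod N) ` {..<k}"
  proof (intro subset_antisym subsetI)
    fix y assume "y \<in> {y. y < N \<and> (x + N - y) mod N < k}"
    then show "y \<in> (\<lambda>s. (x + N - s) mod N) ` {..<k}"
      using circulant_diff(2)[of y N x "(x + N - y) mod N"] x by (intro *) auto
  next
    fix y assume "y \<in> (\<lambda>s. (x + N - s) mod N) ` {..<k}"
    then obtain t where t: "t < k" "y = (x + N - t) mod N" by blast
    then have "y < N" using x by simp
    moreover have "(x + N - y) mod N = t"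
      using circulant_diff(2)[of y N x t] x k t \<open>y < N\<close> by simp
    ultimately show "y \<in> {y. y < N \<and> (x + N - y) mod N < k}" using t by simp
  qed
qed

text \<open>The index k of an edge is recovered from its endpoints as
  \<open>(y + N - x) mod N\<close>; \<open>N\<close> is large enough to keep the four indices
  distinct.\<close>

lemma bip_code_4:
  assumes N: "15 dvd N" "0 < N"
  shows "bip_code 4 N {(x, y). x < N \<and> y < N \<and> (y + N - x) mod N < 4}
    (\<lambda>L. {(x, y). x < N \<and> y < N \<and> (y + N - x) mod N < 4 \<and> lfsr L (x + offset ((y + N - x) mod N))})"
    (is "bip_code 4 N ?E ?A")
proof -
  have N15: "15 \<le> N" using N by (simp add: dvd_imp_le)
  have r: "card {y. (x, y) \<in> ?E} = 4" if "x < N" for x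
    using that circulant_nbrs(1)[of 4 N x] card_circulant(1)[of 4 N x] N15 by simp
  have l: "card {x. (x, y) \<in> ?E} = 4" if "y < N" for y
    using that circulant_nbrs(2)[of 4 N y] card_circulant(2)[of 4 N y] N15 by simp
  have add: "lfsr (sym_diff L M) n \<longleftrightarrow> lfsr L n \<noteq> lfsr M n" for L M n
  proof -
    have *: "(j \<in> sym_diff L M \<and> P) \<longleftrightarrow> (j \<in> L \<and> P) \<noteq> (j \<in> M \<and> P)" for j P by blast
    show ?thesis unfolding lfsr_def * by argo
  qed
  have conn: "bip_connected N (?A L)" if "L \<subseteq> {..<4}" "L \<noteq> {}" for L
    using N that
  proof (rule bip_connected_lfsr)
    fix x k assume xk: "x < N" "k < 4" "lfsr L (x + offset k)"
    then have "((x + k) mod N + N - x) mod N = k"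
      using N15 by (subst circulant_diff(1)) auto
    then show "(x, (x + k) mod N) \<in> ?A L" using xk by simp
  qed
  show ?thesis
    unfolding bip_code_def using N15 r l conn by (auto simp: add)
qed

subsection \<open>From dimension d to dimension d + 1\<close>

text \<open>Here \<open>w\<^sub>0 = {d}\<close>, \<open>w\<^sub>1 = {d, 0}\<close> and \<open>w\<^sub>2 = {d, 1}\<close>, so that \<open>proj d c w\<^sub>c = {}\<close>.\<close>

definition proj :: "nat \<Rightarrow> nat \<Rightarrow> nat set \<Rightarrow> nat set" where
  "proj d c L = sym_diff (L - {d}) (if d \<in> L \<and> c \<noteq> 0 then {c - 1} else {})"

text \<open>
  The label of the edge joining left vertex \<open>x\<close> of copy \<open>c\<close> to copy \<open>c + 1\<close>, evaluated at \<open>L\<close>. It must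
  be nonzero at \<open>w\<^sub>c\<close> and at the next \<open>w\<close>.
\<close>

definition cross :: "nat \<Rightarrow> nat \<Rightarrow> nat \<Rightarrow> nat set \<Rightarrow> bool" where
  "cross d c x L \<longleftrightarrow>
     (if c = 1 \<and> x = 0 then (0 \<in> L) \<noteq> (1 \<in> L)
      else (d \<in> L) \<noteq> (x \<in> L \<and> x < d \<and> x \<noteq> (if c = 0 then 0 else 1)))"

text \<open>Vertex \<open>u\<close> stands for vertex \<open>u div 3\<close> of copy
  \<open>u mod 3\<close>. The same shape serves for the whole graph and for a codeword:
  \<open>B\<close> gives the edges inside the copies, \<open>P\<close> selects the joining
  edges.\<close>

definition triple ::
    "nat \<Rightarrow> (nat \<Rightarrow> (nat \<times> nat) set) \<Rightarrow> (nat \<Rightarrow> nat \<Rightarrow> bool) \<Rightarrow> (nat \<times> nat) set" where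
  "triple N B P = {(u, v). (u mod 3 = v mod 3 \<and> (u div 3, v div 3) \<in> B (u mod 3)) \<or>
     (u < 3 * N \<and> u div 3 = v div 3 \<and> v mod 3 = Suc u mod 3 \<and> P (u mod 3) (u div 3))}"

lemma proj_sym_diff: "proj d c (sym_diff L M) = sym_diff (proj d c L) (proj d c M)"
proof -
  have "sym_diff L M - {d} = sym_diff (L - {d}) (M - {d})" by blast
  then show ?thesis
    unfolding proj_def
    by (cases "d \<in> L"; cases "d \<in> M"; cases "c = 0") (simp_all, blast+)
qed

text \<open>Thus for nonzero \<open>L\<close> copy \<open>c\<close> can lose its inner connection
  only at \<open>w\<^sub>c\<close>.\<close>

lemma proj_empty: "proj d c L = {} \<Longrightarrow> L = {} \<or> L = insert d (if c = 0 then {} else {c - 1})"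
  unfolding proj_def by (auto split: if_splits)

lemma proj_subset: "c < 3 \<Longrightarrow> 2 < d \<Longrightarrow> L \<subseteq> {..<Suc d} \<Longrightarrow> proj d c L \<subseteq> {..<d}"
  unfolding proj_def by (auto simp: less_Suc_eq)

lemma cross_sym_diff: "cross d c x (sym_diff L M) \<longleftrightarrow> cross d c x L \<noteq> cross d c x M"
  unfolding cross_def by auto

text \<open>The excluded vectors are the sums of \<open>w\<^sub>c\<close> and the next
  \<open>w\<close>. For each \<open>c\<close> the labels with \<open>x < d\<close> are
  \<open>d\<close> independent functionals vanishing at that sum, so it is their only common nonzero
  zero; \<open>d \<le> N\<close> provides enough edges to carry them.\<close>

lemma cross_ex:
  assumes "c < 3" "3 < d" "d \<le> N" "L \<subseteq> {..<Suc d}" "L \<noteq> {}"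
    "L \<noteq> (if c = 0 then {0} else if c = 1 then {0, 1} else {1})"
  obtains x where "x < N" "cross d c x L"
proof (cases "d \<in> L")
  case True
  \<comment> \<open>At this \<open>x\<close> the label is the coordinate \<open>d\<close>
    alone.\<close>
  then have "cross d c (if c = 0 then 0 else 1) L" using assms(1) by (auto simp: cross_def)
  then show ?thesis using that[of "if c = 0 then 0 else 1"] assms by simp
next
  case False
  show ?thesis
  proof (cases "L \<subseteq> {0, 1}")
    case True
    then have "cross d c (if c = 0 then 1 else 0) L"
      using assms False unfolding cross_def by (auto split: if_splits)
    then show ?thesis using that[of "if c = 0 then 1 else 0"] assms by auto
  next
    case 2: False
    then obtain j where j: "j \<in> L" "j \<noteq> 0" "j \<noteq> 1" by blast
    then have "j < d" using assms False by (metis less_Suc_eq lessThan_iff subsetD)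
    then have "cross d c j L" using j False by (simp add: cross_def)
    then show ?thesis using that[of j] \<open>j < d\<close> assms(3) by auto
  qed
qed

text \<open>At each \<open>w\<^sub>c\<close> this covers all joining edges at copy \<open>c\<close>:
  those to the next copy and those from the previous one.\<close>

lemma cross_all:
  assumes "1 < d"
  shows "cross d 0 x {d}" "cross d 2 x {d}" "cross d 0 x {d, 0}" "cross d 1 x {d, 0}"
    "cross d 1 x {d, 1}" "cross d 2 x {d, 1}"
  using assms by (auto simp: cross_def)

lemma card_insert_image:
  assumes "inj f" "b \<notin> range f" "finite S"
  shows "card (insert b (f ` S)) = Suc (card S)"
proof -
  have "card (f ` S) = card S" by (rule card_image) (meson assms(1) inj_on_subset subset_UNIV)
  then show ?thesis using assms by (subst card_insert_disjoint) auto
qed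

lemma bip_connected_triple:
  assumes d: "4 \<le> d" "d \<le> N" and L: "L \<subseteq> {..<Suc d}" "L \<noteq> {}"
    and conn: "\<And>M. M \<subseteq> {..<d} \<Longrightarrow> M \<noteq> {} \<Longrightarrow> bip_connected N (A M)"
  shows "bip_connected (3 * N) (triple N (\<lambda>c. A (proj d c L)) (\<lambda>c x. cross d c x L))"
    (is "bip_connected _ ?B")
  unfolding bip_connected_def
proof (intro allI impI)
  fix f g :: "nat \<Rightarrow> bool" and i j
  assume fg: "\<forall>i j. (i, j) \<in> ?B \<longrightarrow> f i = g j" and ij: "i < 3 * N" "j < 3 * N"
  define F where "F c x = f (3 * x + c)" for c x
  define G where "G c x = g (3 * x + c)" for c x
  have inner: "F c x = G c y" if "c < 3" "proj d c L \<noteq> {}" "x < N" "y < N" for c x y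
  proof -
    have "\<forall>x y. (x, y) \<in> A (proj d c L) \<longrightarrow> F c x = G c y"
    proof (intro allI impI)
      fix x y assume "(x, y) \<in> A (proj d c L)"
      then have "(3 * x + c, 3 * y + c) \<in> ?B" using that(1) by (simp add: triple_def)
      then show "F c x = G c y" using fg by (simp add: F_def G_def)
    qed
    moreover have "bip_connected N (A (proj d c L))"
      using conn that proj_subset[of c d L] d L by simp
    ultimately show ?thesis using that unfolding bip_connected_def by blast
  qed
  have outer: "F c x = G e x" if "cross d c x L" "x < N" "c < 3" "e = Suc c mod 3" for c e x
  proof -
    have "(3 * x + c, 3 * x + e) \<in> ?B" using that by (simp add: triple_def mod_Suc)
    then show ?thesis using fg by (simp add: F_def G_def)
  qed
  have N: "0 < N" using d by simp
  have o: "F 0 x = G 1 x" if "cross d 0 x L" "x < N" for x using outer[OF that] by simp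
  have o1: "F 1 x = G 2 x" if "cross d 1 x L" "x < N" for x
    using outer[OF that] by (simp add: numeral_2_eq_2)
  have o2: "F 2 x = G 0 x" if "cross d 2 x L" "x < N" for x using outer[OF that] by simp
  have ex: "\<exists>x<N. cross d c x L"
    if "c < 3" "L \<noteq> (if c = 0 then {0} else if c = 1 then {0, 1} else {1})" for c
    using cross_ex[OF that(1) _ d(2) L that(2)] d(1) by auto
  have const: "\<exists>b. \<forall>c<3. \<forall>x<N. F c x = b \<and> G c x = b"
  proof -
    have all3: "(\<forall>c<3. P c) \<longleftrightarrow> P 0 \<and> P 1 \<and> P 2" for P :: "nat \<Rightarrow> bool"
      by (auto simp: numeral_3_eq_3 less_Suc_eq numeral_2_eq_2)
    consider "L = {d}" | "L = {d, 0}" | "L = {d, 1}" | "L \<notin> {{d}, {d, 0}, {d, 1}}" by blast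
    then show ?thesis
    proof cases
      case 1
      then have "proj d 1 L \<noteq> {}" "proj d 2 L \<noteq> {}" using d by (auto simp: proj_def)
      then have a: "F 1 x = G 1 y" "F 2 x = G 2 y" if "x < N" "y < N" for x y
        using inner[of 1 x y] inner[of 2 x y] that by simp_all
      \<comment> \<open>Here \<open>L\<close> is \<open>w\<^sub>0\<close>: the left vertices of copy
        0 hang on copy 1, its right vertices on copy 2. The next two cases are rotations of this
        one.\<close>
      have b: "F 0 x = G 1 x" "F 2 x = G 0 x" if "x < N" for x
        using o o2 that cross_all d 1 by auto
      \<comment> \<open>Copies 1 and 2 are linked directly, since \<open>w\<^sub>0\<close> differs
        from the sum of \<open>w\<^sub>1\<close> and \<open>w\<^sub>2\<close>.\<close>
      obtain z where z: "z < N" "F 1 z = G 2 z" using ex[of 1] o1 d 1 by auto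
      have v: "F 0 x = G 0 z \<and> G 0 x = G 0 z \<and> F 1 x = G 0 z \<and> G 1 x = G 0 z \<and> F 2 x = G 0 z \<and>
          G 2 x = G 0 z" if "x < N" for x
        using a[OF that that] a[OF that z(1)] a[OF z(1) that] a[OF z(1) z(1)]
          b[OF that] b[OF z(1)] z(2) by argo
      show ?thesis unfolding all3 by (intro exI[of _ "G 0 z"]) (use v in blast)
    next
      case 2
      then have "proj d 0 L \<noteq> {}" "proj d 2 L \<noteq> {}" using d by (auto simp: proj_def)
      then have a: "F 0 x = G 0 y" "F 2 x = G 2 y" if "x < N" "y < N" for x y
        using inner[of 0 x y] inner[of 2 x y] that by simp_all
      have b: "F 0 x = G 1 x" "F 1 x = G 2 x" if "x < N" for x
        using o o1 that cross_all d 2 by auto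
      obtain z where z: "z < N" "F 2 z = G 0 z" using ex[of 2] o2 d 2 by auto
      have v: "F 0 x = G 0 z \<and> G 0 x = G 0 z \<and> F 1 x = G 0 z \<and> G 1 x = G 0 z \<and> F 2 x = G 0 z \<and>
          G 2 x = G 0 z" if "x < N" for x
        using a[OF that that] a[OF that z(1)] a[OF z(1) that] a[OF z(1) z(1)]
          b[OF that] b[OF z(1)] z(2) by argo
      show ?thesis unfolding all3 by (intro exI[of _ "G 0 z"]) (use v in blast)
    next
      case 3
      then have "proj d 0 L \<noteq> {}" "proj d 1 L \<noteq> {}" using d by (auto simp: proj_def)
      then have a: "F 0 x = G 0 y" "F 1 x = G 1 y" if "x < N" "y < N" for x y
        using inner[of 0 x y] inner[of 1 x y] that by simp_all
      have b: "F 1 x = G 2 x" "F 2 x = G 0 x" if "x < N" for x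
        using o1 o2 that cross_all d 3 by auto
      obtain z where z: "z < N" "F 0 z = G 1 z" using ex[of 0] o d 3 by auto
      have v: "F 0 x = G 0 z \<and> G 0 x = G 0 z \<and> F 1 x = G 0 z \<and> G 1 x = G 0 z \<and> F 2 x = G 0 z \<and>
          G 2 x = G 0 z" if "x < N" for x
        using a[OF that that] a[OF that z(1)] a[OF z(1) that] a[OF z(1) z(1)]
          b[OF that] b[OF z(1)] z(2) by argo
      show ?thesis unfolding all3 by (intro exI[of _ "G 0 z"]) (use v in blast)
    next
      case 4
      then have "proj d 0 L \<noteq> {}" "proj d 1 L \<noteq> {}" "proj d 2 L \<noteq> {}"
        using L(2) proj_empty[of d 0 L] proj_empty[of d 1 L] proj_empty[of d 2 L] by auto
      then have a: "F 0 x = G 0 y" "F 1 x = G 1 y" "F 2 x = G 2 y" if "x < N" "y < N" for x y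
        using inner[of 0 x y] inner[of 1 x y] inner[of 2 x y] that by simp_all
      have e: "L \<noteq> {0} \<Longrightarrow> \<exists>z<N. F 0 z = G 1 z" "L \<noteq> {0, 1} \<Longrightarrow> \<exists>z<N. F 1 z = G 2 z"
        "L \<noteq> {1} \<Longrightarrow> \<exists>z<N. F 2 z = G 0 z"
        using ex[of 0] ex[of 1] ex[of 2] o o1 o2 by auto
      have "F 0 0 = F 1 0 \<and> F 1 0 = F 2 0"
      proof -
        have "L \<noteq> {0} \<Longrightarrow> F 0 0 = F 1 0" "L \<noteq> {0, 1} \<Longrightarrow> F 1 0 = F 2 0" "L \<noteq> {1} \<Longrightarrow> F 2 0 = F 0 0"
          using a e N by metis+
        \<comment> \<open>The three exceptional sums are distinct, so at most one link is missing,
          and two links join three connected copies.\<close>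
        moreover have "{0} \<noteq> {0, 1 :: nat}" "{0} \<noteq> {1 :: nat}" "{1} \<noteq> {0, 1 :: nat}" by auto
        ultimately show ?thesis by metis
      qed
      then have v: "F 0 x = F 0 0 \<and> G 0 x = F 0 0 \<and> F 1 x = F 0 0 \<and> G 1 x = F 0 0 \<and> F 2 x = F 0 0 \<and>
          G 2 x = F 0 0" if "x < N" for x
        using a[OF that N] a[OF N that] a[OF N N] by argo
      show ?thesis unfolding all3 by (intro exI[of _ "F 0 0"]) (use v in blast)
    qed
  qed
  have "f i = F (i mod 3) (i div 3)" "g j = G (j mod 3) (j div 3)"
    by (simp_all add: F_def G_def)
  moreover have "i div 3 < N" "j div 3 < N" using ij by auto
  ultimately show "f i = g j" using const by (metis mod_less_divisor zero_less_numeral)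
qed

text \<open>Each left vertex gains one edge to the next copy and each right vertex one from the
  previous copy, which raises all degrees by one.\<close>

lemma bip_code_Suc:
  assumes code: "bip_code d N E A" and d: "4 \<le> d"
  shows "bip_code (Suc d) (3 * N) (triple N (\<lambda>_. E) (\<lambda>_ _. True))
    (\<lambda>L. triple N (\<lambda>c. A (proj d c L)) (\<lambda>c x. cross d c x L))"
proof -
  note D = bip_codeD[OF code]
  let ?E = "triple N (\<lambda>_. E) (\<lambda>_ _. True)"
  have fin: "finite {y. (x, y) \<in> E}" "finite {x. (x, y) \<in> E}" for x y
    by (rule finite_subset[of _ "{..<N}"]; use D(2) in auto)+
  have inj: "inj (\<lambda>y. 3 * y + c)" for c :: nat by (simp add: inj_def)
  have ran: "3 * x + a \<notin> range (\<lambda>y. 3 * y + b)" if "a < 3" "b < 3" "a \<noteq> b" for a b x :: nat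
  proof
    assume "3 * x + a \<in> range (\<lambda>y. 3 * y + b)"
    then obtain y where "3 * x + a = 3 * y + b" by blast
    then have "(3 * x + a) mod 3 = (3 * y + b) mod 3" by simp
    then show False using that by simp
  qed
  have r: "card {v. (u, v) \<in> ?E} = Suc d" if "u < 3 * N" for u
  proof -
    have "{v. (u, v) \<in> ?E} =
        insert (3 * (u div 3) + Suc u mod 3) ((\<lambda>y. 3 * y + u mod 3) ` {y. (u div 3, y) \<in> E})"
    proof (intro set_eqI iffI)
      fix v assume "v \<in> {v. (u, v) \<in> ?E}"
      then consider "v mod 3 = u mod 3" "(u div 3, v div 3) \<in> E"
        | "v mod 3 = Suc u mod 3" "v div 3 = u div 3"
        by (auto simp: triple_def)
      then show "v \<in> insert (3 * (u div 3) + Suc u mod 3)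
          ((\<lambda>y. 3 * y + u mod 3) ` {y. (u div 3, y) \<in> E})"
      proof cases
        case 1
        then have "v = 3 * (v div 3) + u mod 3" by (metis mult_div_mod_eq)
        with 1 show ?thesis by blast
      next
        case 2
        then have "v = 3 * (u div 3) + Suc u mod 3" by (metis mult_div_mod_eq)
        then show ?thesis by blast
      qed
    qed (use that in \<open>auto simp: triple_def\<close>)
    moreover have "3 * (u div 3) + Suc u mod 3 \<notin> range (\<lambda>y. 3 * y + u mod 3)"
      by (rule ran) (auto simp: mod_Suc)
    moreover have "card {y. (u div 3, y) \<in> E} = d" using D(3) that by simp
    ultimately show ?thesis using card_insert_image[OF inj _ fin(1)] by simp
  qed
  have l: "card {u. (u, v) \<in> ?E} = Suc d" if "v < 3 * N" for v
  proof -
    \<comment> \<open>The previous copy is written with \<open>v + 2\<close>, avoiding subtraction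
      modulo 3.\<close>
    have pred: "v mod 3 = Suc u mod 3 \<longleftrightarrow> u mod 3 = (v + 2) mod 3" for u
    proof
      assume "v mod 3 = Suc u mod 3"
      then have "(v + 2) mod 3 = (Suc u + 2) mod 3" by (rule mod_add_cong) simp
      then show "u mod 3 = (v + 2) mod 3" by simp
    next
      assume "u mod 3 = (v + 2) mod 3"
      then have "(u + 1) mod 3 = (v + 2 + 1) mod 3" by (rule mod_add_cong) simp
      then show "v mod 3 = Suc u mod 3" by simp
    qed
    have lt: "3 * (v div 3) + (v + 2) mod 3 < 3 * N"
    proof -
      have "v div 3 < N" "(v + 2) mod 3 < 3" using that by auto
      then show ?thesis by linarith
    qed
    have "{u. (u, v) \<in> ?E} =
        insert (3 * (v div 3) + (v + 2) mod 3) ((\<lambda>y. 3 * y + v mod 3) ` {y. (y, v div 3) \<in> E})"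
    proof (intro set_eqI iffI)
      fix u assume "u \<in> {u. (u, v) \<in> ?E}"
      then consider "u mod 3 = v mod 3" "(u div 3, v div 3) \<in> E"
        | "u mod 3 = (v + 2) mod 3" "u div 3 = v div 3"
        by (auto simp: triple_def pred)
      then show "u \<in> insert (3 * (v div 3) + (v + 2) mod 3)
          ((\<lambda>y. 3 * y + v mod 3) ` {y. (y, v div 3) \<in> E})"
      proof cases
        case 1
        then have "u = 3 * (u div 3) + v mod 3" by (metis mult_div_mod_eq)
        with 1 show ?thesis by blast
      next
        case 2
        then have "u = 3 * (v div 3) + (v + 2) mod 3" by (metis mult_div_mod_eq)
        then show ?thesis by blast
      qed
    qed (use lt in \<open>auto simp: triple_def pred\<close>)
    moreover have "3 * (v div 3) + (v + 2) mod 3 \<notin> range (\<lambda>y. 3 * y + v mod 3)"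
      by (rule ran) (use pred[of v] in \<open>auto simp: mod_Suc\<close>)
    moreover have "card {y. (y, v div 3) \<in> E} = d" using D(4) that by simp
    ultimately show ?thesis using card_insert_image[OF inj _ fin(2)] by simp
  qed
  have sub: "?E \<subseteq> {..<3 * N} \<times> {..<3 * N}"
  proof
    fix p assume "p \<in> ?E"
    then obtain u v where p: "p = (u, v)"
      and *: "(u div 3, v div 3) \<in> E \<or> u < 3 * N \<and> u div 3 = v div 3"
      by (auto simp: triple_def)
    then have "u div 3 < N \<and> v div 3 < N" using D(2) by auto
    then show "p \<in> {..<3 * N} \<times> {..<3 * N}" using p by auto
  qed
  have sub2: "triple N (\<lambda>c. A (proj d c L)) (\<lambda>c x. cross d c x L) \<subseteq> ?E" for L
    using D(5) by (auto simp: triple_def)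
  have add: "triple N (\<lambda>c. A (proj d c (sym_diff L M))) (\<lambda>c x. cross d c x (sym_diff L M)) =
      sym_diff (triple N (\<lambda>c. A (proj d c L)) (\<lambda>c x. cross d c x L))
        (triple N (\<lambda>c. A (proj d c M)) (\<lambda>c x. cross d c x M))" for L M
  proof -
    \<comment> \<open>Inner and joining edges are disjoint, so symmetric differences can be formed
      separately on each kind.\<close>
    have ne: "u mod 3 = v mod 3 \<Longrightarrow> v mod 3 \<noteq> Suc u mod 3" for u v :: nat by (simp add: mod_Suc)
    show ?thesis
      unfolding proj_sym_diff D(6) cross_sym_diff triple_def by (auto dest: ne)
  qed
  have "Suc d \<le> 3 * N" using D(1) d by simp
  then show ?thesis
    unfolding bip_code_def
    by (intro conjI allI impI bip_connected_triple[OF d D(1) _ _ D(7)] r l sub sub2 add)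
qed

lemma bip_code_ex:
  assumes "4 \<le> d" "15 dvd m" "0 < m"
  shows "\<exists>E A. bip_code d (3 ^ (d - 4) * m) E A"
  using assms(1)
proof (induction d rule: dec_induct)
  case base
  then show ?case using bip_code_4[OF assms(2,3)] by auto
next
  case (step n)
  then obtain E A where "bip_code n (3 ^ (n - 4) * m) E A" by blast
  from bip_code_Suc[OF this step(1)]
  obtain E' A' where "bip_code (Suc n) (3 * (3 ^ (n - 4) * m)) E' A'" by blast
  moreover have "3 * (3 ^ (n - 4) * m) = 3 ^ (Suc n - 4) * m"
    using Suc_diff_le[OF step(1)] by (simp only: power_Suc mult.assoc)
  ultimately show ?case by metis
qed

subsection \<open>From bipartite codes to graphs\<close>

text \<open>Parity separates the two sides: left vertices become even numbers, right vertices odd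
  ones.\<close>

definition pair_edge :: "nat \<times> nat \<Rightarrow> nat set" where
  "pair_edge p = {2 * fst p, Suc (2 * snd p)}"

definition bip_graph :: "nat \<Rightarrow> (nat \<times> nat) set \<Rightarrow> nat graph" where
  "bip_graph N E = Graph {..<2 * N} (pair_edge ` E)"

lemma double_neq_Suc_double: "2 * i \<noteq> Suc (2 * j)" "Suc (2 * j) \<noteq> 2 * (i :: nat)"
  by presburger+

lemma pair_edge_eq_iff: "pair_edge p = pair_edge q \<longleftrightarrow> p = q"
  unfolding pair_edge_def by (auto simp: doubleton_eq_iff double_neq_Suc_double prod_eq_iff)

lemma inj_pair_edge: "inj pair_edge"
  by (simp add: inj_def pair_edge_eq_iff)

lemma pair_edge_image_sym_diff:
  "pair_edge ` sym_diff B C = sym_diff (pair_edge ` B) (pair_edge ` C)"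
  by (simp add: image_Un image_set_diff[OF inj_pair_edge])

lemma nat_less_double_cases:
  assumes "v < 2 * (N :: nat)"
  obtains i where "v = 2 * i" "i < N" | i where "v = Suc (2 * i)" "i < N"
proof (cases "even v")
  case True
  then obtain i where "v = 2 * i" by blast
  then show ?thesis using that(1) assms by simp
next
  case False
  then obtain i where "v = Suc (2 * i)" by (metis oddE Suc_eq_plus1)
  then show ?thesis using that(2) assms by simp
qed

lemma simple_bip_graph:
  assumes "E \<subseteq> {..<N} \<times> {..<N}"
  shows "simple_graph (bip_graph N E)"
  using assms unfolding simple_graph_def bip_graph_def
  by (auto simp: pair_edge_def card_2_iff' double_neq_Suc_double)

lemma bipartite_bip_graph:
  assumes "E \<subseteq> {..<N} \<times> {..<N}"
  shows "bipartite (bip_graph N E)"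
proof -
  let ?X = "(\<lambda>i. 2 * i) ` {..<N}" and ?Y = "(\<lambda>i. Suc (2 * i)) ` {..<N}"
  have "?X \<union> ?Y = {..<2 * N}" by (auto elim: nat_less_double_cases)
  moreover have "?X \<inter> ?Y = {}" by (auto simp: double_neq_Suc_double)
  moreover have "\<forall>e\<in>pair_edge ` E. \<exists>x\<in>?X. \<exists>y\<in>?Y. e = {x, y}"
    using assms by (fastforce simp: pair_edge_def)
  ultimately show ?thesis unfolding bipartite_def bip_graph_def graph.sel by blast
qed

lemma regular_bip_graph:
  assumes "\<And>i. i < N \<Longrightarrow> card {j. (i, j) \<in> E} = d" "\<And>j. j < N \<Longrightarrow> card {i. (i, j) \<in> E} = d"
  shows "regular d (bip_graph N E)"
  unfolding regular_def
proof
  fix v assume "v \<in> verts (bip_graph N E)"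
  then have "v < 2 * N" by (simp add: bip_graph_def)
  then show "degree (bip_graph N E) v = d"
  proof (cases rule: nat_less_double_cases)
    case (1 i)
    have "{e \<in> edges (bip_graph N E). v \<in> e} = (\<lambda>j. pair_edge (i, j)) ` {j. (i, j) \<in> E}"
      using 1 by (fastforce simp: bip_graph_def pair_edge_def double_neq_Suc_double image_def Bex_def)
    moreover have "inj (\<lambda>j. pair_edge (i, j))" by (simp add: inj_def pair_edge_eq_iff)
    ultimately show ?thesis
      using assms(1)[OF 1(2)] by (simp add: degree_def card_image inj_on_subset)
  next
    case (2 j)
    have "{e \<in> edges (bip_graph N E). v \<in> e} = (\<lambda>i. pair_edge (i, j)) ` {i. (i, j) \<in> E}"
      using 2 by (fastforce simp: bip_graph_def pair_edge_def double_neq_Suc_double image_def Bex_def)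
    moreover have "inj (\<lambda>i. pair_edge (i, j))" by (simp add: inj_def pair_edge_eq_iff)
    ultimately show ?thesis
      using assms(2)[OF 2(2)] by (simp add: degree_def card_image inj_on_subset)
  qed
qed

text \<open>Reachability from a fixed vertex \<open>u\<close> is a two-colouring constant along
  edges, hence constant; since \<open>u\<close> reaches itself, it reaches every vertex.\<close>

lemma connected_spanning_bip_graph:
  assumes N: "0 < N" and B: "B \<subseteq> E" "bip_connected N B"
  shows "connected_spanning (bip_graph N E) (pair_edge ` B)"
proof -
  define R where "R = {(x, y). {x, y} \<in> pair_edge ` B}"
  have "(u, v) \<in> R\<^sup>*" if uv: "u < 2 * N" "v < 2 * N" for u v
  proof -
    have "\<forall>i j. (i, j) \<in> B \<longrightarrow> ((u, 2 * i) \<in> R\<^sup>*) = ((u, Suc (2 * j)) \<in> R\<^sup>*)"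
    proof (intro allI impI)
      fix i j assume "(i, j) \<in> B"
      then have "{2 * i, Suc (2 * j)} \<in> pair_edge ` B" by (force simp: pair_edge_def)
      then have "(2 * i, Suc (2 * j)) \<in> R" "(Suc (2 * j), 2 * i) \<in> R"
        by (auto simp: R_def insert_commute)
      then show "((u, 2 * i) \<in> R\<^sup>*) = ((u, Suc (2 * j)) \<in> R\<^sup>*)"
        by (meson rtrancl.rtrancl_into_rtrancl)
    qed
    then have eq: "((u, 2 * i) \<in> R\<^sup>*) = ((u, Suc (2 * j)) \<in> R\<^sup>*)" if "i < N" "j < N" for i j
      using B(2) that unfolding bip_connected_def
      by (elim allE[of _ "\<lambda>i. (u, 2 * i) \<in> R\<^sup>*"] allE[of _ "\<lambda>j. (u, Suc (2 * j)) \<in> R\<^sup>*"]) blast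
    have "(u, u) \<in> R\<^sup>*" by simp
    with uv(1) have "(u, 0) \<in> R\<^sup>*"
    proof (cases rule: nat_less_double_cases)
      case (1 i)
      then show ?thesis using eq[of i 0] eq[of 0 0] N \<open>(u, u) \<in> R\<^sup>*\<close> by auto
    next
      case (2 i)
      then show ?thesis using eq[of 0 i] N \<open>(u, u) \<in> R\<^sup>*\<close> by auto
    qed
    with uv(2) show ?thesis
    proof (cases rule: nat_less_double_cases)
      case (1 i)
      then show ?thesis using eq[of i 0] eq[of 0 0] N \<open>(u, 0) \<in> R\<^sup>*\<close> by auto
    next
      case (2 i)
      then show ?thesis using eq[of 0 i] N \<open>(u, 0) \<in> R\<^sup>*\<close> by auto
    qed
  qed
  then show ?thesis
    using N B(1)
    by (auto simp: connected_spanning_def connected_graph_def bip_graph_def R_def lessThan_empty_iff)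
qed

section \<open>The linear code and its dimension\<close>

context
  fixes d N E A
  assumes code: "bip_code d N E A" and d: "0 < d"
begin

lemmas code_props = bip_codeD[OF code]

abbreviation "word L \<equiv> pair_edge ` A L"

lemma word_sym_diff: "word (sym_diff L M) = sym_diff (word L) (word M)"
  by (simp only: code_props(6) pair_edge_image_sym_diff)

lemma word_empty: "word {} = {}"
  using word_sym_diff[of "{}" "{}"] by simp

lemma word_connected:
  "L \<subseteq> {..<d} \<Longrightarrow> L \<noteq> {} \<Longrightarrow> connected_spanning (bip_graph N E) (word L)"
  using connected_spanning_bip_graph[OF _ code_props(5) code_props(7)] code_props(1) d by simp

text \<open>There are at least two vertices, so the empty edge set does not connect them. This gives
  the linear map from vectors to codewords a trivial kernel.\<close>

lemma word_nonempty:
  assumes "L \<subseteq> {..<d}" "L \<noteq> {}"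
  shows "word L \<noteq> {}"
proof
  assume "word L = {}"
  then have c: "connected_graph (Graph {..<2 * N} {} :: nat graph)"
    using word_connected[OF assms] by (simp add: connected_spanning_def bip_graph_def)
  have "0 < 2 * N" "1 < 2 * N" using code_props(1) d by auto
  then have "(0, 1 :: nat) \<in> {}\<^sup>*" using c by (auto simp: connected_graph_def)
  then show False by simp
qed

lemma inj_on_word: "inj_on (\<lambda>L. word L) (Pow {..<d})"
proof (rule inj_onI, rule ccontr)
  fix L M assume *: "L \<in> Pow {..<d}" "M \<in> Pow {..<d}" "word L = word M" "L \<noteq> M"
  then have "word (sym_diff L M) = {}" by (simp only: word_sym_diff) simp
  moreover have "sym_diff L M \<subseteq> {..<d}" "sym_diff L M \<noteq> {}" using * by auto
  ultimately show False using word_nonempty by blast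
qed

lemma connectivity_code_words:
  "connectivity_code (bip_graph N E) ((\<lambda>L. word L) ` Pow {..<d})"
  unfolding connectivity_code_def
proof (intro conjI ballI impI)
  show "(\<lambda>L. word L) ` Pow {..<d} \<subseteq> Pow (edges (bip_graph N E))"
    using code_props(5) by (fastforce simp: bip_graph_def)
  fix B C assume "B \<in> (\<lambda>L. word L) ` Pow {..<d}" "C \<in> (\<lambda>L. word L) ` Pow {..<d}" "B \<noteq> C"
  then obtain L M where LM: "B = word L" "C = word M" "L \<subseteq> {..<d}" "M \<subseteq> {..<d}" "L \<noteq> M"
    by auto
  then have "sym_diff L M \<subseteq> {..<d}" "sym_diff L M \<noteq> {}" by auto
  from word_connected[OF this] show "connected_spanning (bip_graph N E) (sym_diff B C)"
    by (simp only: LM word_sym_diff)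
qed

text \<open>The codewords attain the upper bound obtained from the edges at a single vertex.\<close>

lemma max_code_size_bip_graph: "max_code_size (bip_graph N E) = 2 ^ d"
proof -
  let ?H = "bip_graph N E"
  let ?K = "{\<C>. connectivity_code ?H \<C>}"
  have H: "simple_graph ?H" "regular d ?H"
    using simple_bip_graph[OF code_props(2)] regular_bip_graph[OF code_props(3,4)] by auto
  have "?K \<subseteq> Pow (Pow (edges ?H))" by (auto simp: connectivity_code_def)
  then have fin: "finite ?K" using finite_edges[OF H(1)] by (meson finite_Pow_iff finite_subset)
  have "card ((\<lambda>L. word L) ` Pow {..<d}) = 2 ^ d"
    using card_image[OF inj_on_word] by (simp add: card_Pow)
  then have "2 ^ d \<in> card ` ?K" using connectivity_code_words by force
  then show ?thesis
    unfolding max_code_size_def using fin code_card_le[OF H d] by (intro Max_eqI) auto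
qed

interpretation vs: vector_space f2_scale
  by (rule vector_space_f2_scale)

lemma char_vec_eq_iff: "char_vec S = char_vec T \<longleftrightarrow> S = T"
  by (auto simp: char_vec_def fun_eq_iff split: if_splits)

lemma char_vec_empty: "char_vec {} = 0"
  by (simp add: char_vec_def fun_eq_iff)

lemma char_vec_word_sum:
  assumes "finite L"
  shows "char_vec (word L) = (\<Sum>j\<in>L. char_vec (word {j}))"
  using assms
proof (induction L)
  case empty
  show ?case by (simp only: word_empty char_vec_empty sum.empty)
next
  case (insert j L)
  then have "insert j L = sym_diff {j} L" by auto
  then have "char_vec (word (insert j L)) = char_vec (word {j}) + char_vec (word L)"
    by (simp only: word_sym_diff char_vec_sym_diff)
  then show ?case using insert by simp
qed

lemma subspace_words: "vs.subspace (char_vec ` (\<lambda>L. word L) ` Pow {..<d})"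
  unfolding vs.subspace_def
proof (intro conjI ballI allI)
  have z: "0 = char_vec (word {})" by (simp only: word_empty char_vec_empty)
  then show zero: "0 \<in> char_vec ` (\<lambda>L. word L) ` Pow {..<d}" by blast
  fix x assume x: "x \<in> char_vec ` (\<lambda>L. word L) ` Pow {..<d}"
  show "f2_scale c x \<in> char_vec ` (\<lambda>L. word L) ` Pow {..<d}" for c
  proof (cases "c = 0")
    case True
    then have "f2_scale c x = 0" by (simp add: f2_scale_def fun_eq_iff)
    with zero show ?thesis by (simp only:)
  next
    case False
    then have "f2_scale c x = x" by (simp add: bit_not_zero_iff f2_scale_def fun_eq_iff)
    then show ?thesis using x by simp
  qed
  fix y assume "y \<in> char_vec ` (\<lambda>L. word L) ` Pow {..<d}"
  with x obtain L M where LM: "L \<subseteq> {..<d}" "M \<subseteq> {..<d}" "x = char_vec (word L)" "y = char_vec (word M)"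
    by auto
  then have "x + y = char_vec (word (sym_diff L M))"
    by (simp only: word_sym_diff char_vec_sym_diff)
  moreover have "sym_diff L M \<in> Pow {..<d}" using LM by auto
  ultimately show "x + y \<in> char_vec ` (\<lambda>L. word L) ` Pow {..<d}" by blast
qed

lemma dim_words: "code_dim ((\<lambda>L. word L) ` Pow {..<d}) = d"
proof -
  let ?S = "char_vec ` (\<lambda>L. word L) ` Pow {..<d}"
  define b where "b j = char_vec (word {j})" for j
  have inj: "inj_on b {..<d}"
  proof (rule inj_onI)
    fix i j assume *: "i \<in> {..<d}" "j \<in> {..<d}" "b i = b j"
    then have "word {i} = word {j}" by (simp add: b_def char_vec_eq_iff)
    then have "{i} = {j}" using inj_onD[OF inj_on_word, of "{i}" "{j}"] * by simp
    then show "i = j" by simp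
  qed
  have indep: "vs.independent (b ` {..<d})"
  proof
    assume "vs.dependent (b ` {..<d})"
    then obtain u where u: "\<exists>v\<in>b ` {..<d}. u v \<noteq> 0" "(\<Sum>v\<in>b ` {..<d}. f2_scale (u v) v) = 0"
      by (auto simp: vs.dependent_finite)
    \<comment> \<open>Nonzero coefficients in the two-element field are 1, so a dependency is the
      sum over its support \<open>L\<close>, which is the codeword of \<open>L\<close>.\<close>
    define L where "L = {j. j < d \<and> u (b j) \<noteq> 0}"
    have L: "L \<subseteq> {..<d}" "L \<noteq> {}" using u(1) by (auto simp: L_def)
    have "char_vec (word L) = (\<Sum>j\<in>L. b j)"
      unfolding b_def using char_vec_word_sum L(1) finite_subset by blast
    also have "\<dots> = (\<Sum>j<d. f2_scale (u (b j)) (b j))"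
    proof (rule sum.mono_neutral_cong_left)
      show "\<forall>j\<in>{..<d} - L. f2_scale (u (b j)) (b j) = 0"
        by (auto simp: L_def f2_scale_def fun_eq_iff)
      show "b j = f2_scale (u (b j)) (b j)" if "j \<in> L" for j
        using that by (auto simp: L_def f2_scale_def fun_eq_iff)
    qed (use L in auto)
    also have "\<dots> = 0" using u(2) unfolding sum.reindex[OF inj] by simp
    finally have "word L = {}" by (metis char_vec_empty char_vec_eq_iff)
    then show False using word_nonempty L by blast
  qed
  have sub: "b ` {..<d} \<subseteq> ?S" by (auto simp: b_def)
  have span: "?S \<subseteq> vs.span (b ` {..<d})"
  proof
    fix x assume "x \<in> ?S"
    then obtain L where L: "L \<subseteq> {..<d}" "x = char_vec (word L)" by auto
    have "x = (\<Sum>j\<in>L. b j)" using L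
      unfolding b_def using char_vec_word_sum finite_subset by blast
    moreover have "(\<Sum>j\<in>L. b j) \<in> vs.span (b ` {..<d})"
      by (rule vs.span_sum, rule vs.span_base) (use L in blast)
    ultimately show "x \<in> vs.span (b ` {..<d})" by (simp only:)
  qed
  have "vs.dim ?S = card (b ` {..<d})" by (rule vs.dim_unique[OF sub span indep refl])
  then show ?thesis using inj by (simp add: code_dim_def card_image)
qed

lemma bip_graph_properties:
  "simple_graph (bip_graph N E) \<and> regular d (bip_graph N E) \<and> bipartite (bip_graph N E) \<and>
    (\<exists>\<C>. linear_code (bip_graph N E) \<C> \<and> code_dim \<C> = d)"
  using simple_bip_graph[OF code_props(2)] regular_bip_graph[OF code_props(3,4)] bipartite_bip_graph[OF code_props(2)]
    connectivity_code_words subspace_words dim_words unfolding linear_code_def by blast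

end

section \<open>Infinite families and the value of f\<close>

lemma bip_graphs_infinite:
  assumes d: "4 \<le> d"
    and P: "\<And>N E A. bip_code d N E A \<Longrightarrow> P (bip_graph N E)"
  shows "infinitely_many_nonisomorphic P"
proof -
  have "\<forall>m. \<exists>E A. bip_code d (3 ^ (d - 4) * (15 * Suc m)) E A"
    using bip_code_ex[OF d] by simp
  then obtain E A where EA: "\<And>m. bip_code d (3 ^ (d - 4) * (15 * Suc m)) (E m) (A m)" by metis
  define H where "H m = bip_graph (3 ^ (d - 4) * (15 * Suc m)) (E m)" for m
  \<comment> \<open>The number of vertices determines \<open>m\<close>, which rules out isomorphisms
    within the family.\<close>
  have card: "card (verts (H m)) = 30 * 3 ^ (d - 4) * Suc m" for m
    by (simp add: H_def bip_graph_def algebra_simps)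
  have inj: "inj H"
  proof (rule injI)
    fix m n assume "H m = H n"
    then have "card (verts (H m)) = card (verts (H n))" by (rule arg_cong)
    then show "m = n" unfolding card by simp
  qed
  have "infinite (range H)" using inj by (simp add: finite_image_iff)
  moreover have "pairwise (\<lambda>G H. \<not> isomorphic G H) (range H)"
    unfolding pairwise_def
  proof (intro ballI impI notI)
    fix G K assume GK: "G \<in> range H" "K \<in> range H" "G \<noteq> K" "isomorphic G K"
    then obtain m n where mn: "G = H m" "K = H n" by auto
    from GK(4) have "card (verts G) = card (verts K)"
      unfolding isomorphic_def using bij_betw_same_card by blast
    then have "m = n" unfolding mn card by simp
    then show False using GK mn by simp
  qed
  moreover have "\<forall>G\<in>range H. P G" using P[OF EA] by (auto simp: H_def)
  ultimately show ?thesis unfolding infinitely_many_nonisomorphic_def by blast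
qed

theorem theorem1p2:
  fixes d :: nat
  assumes "d \<ge> 4"
  shows "f_max d = 2 ^ d \<and>
    infinitely_many_nonisomorphic
      (\<lambda>H. simple_graph H \<and> regular d H \<and> bipartite H \<and>
        (\<exists>\<C>. linear_code H \<C> \<and> code_dim \<C> = d))"
proof
  have d: "0 < d" using assms by simp
  have le: "q \<le> 2 ^ d" if "q \<in> recurring_code_sizes d" for q
    using recurring_code_sizes_le[OF d that] .
  have "2 ^ d \<in> recurring_code_sizes d"
    unfolding recurring_code_sizes_def mem_Collect_eq
    using bip_graph_properties max_code_size_bip_graph d
    by (intro bip_graphs_infinite[OF assms]) blast
  moreover have "finite (recurring_code_sizes d)"
    using le by (meson finite_nat_set_iff_bounded_le)
  ultimately show "f_max d = 2 ^ d"
    unfolding f_max_def using le by (intro Max_eqI) auto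
  show "infinitely_many_nonisomorphic
      (\<lambda>H. simple_graph H \<and> regular d H \<and> bipartite H \<and>
        (\<exists>\<C>. linear_code H \<C> \<and> code_dim \<C> = d))"
    using bip_graph_properties[OF _ d] by (rule bip_graphs_infinite[OF assms])
qed

end
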